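(* The Boolean query EVEN is not definable in $\exists^{\log^\omega}\mathrm{IFP}$: there is no sentence $\phi$ of $\exists^{\log^\omega}\mathrm{IFP}[\{E\}]$ such that for every finite graph $\mathcal G$ (with vertex set $V$), $\mathcal G\models\phi$ iff $|V|$ is even.
   Context: Graphs are finite structures over the signature $\{E\}$ with $E$ binary (no built-in order). $\log(n)=\lceil\log_2 n\rceil$, $\log^k(n)=(\log(n))^k$. IFP is first-order logic extended by the inflationary fixed-point operator. For $k>0$, $\exists^{\log^k}$ is the second-order quantifier with semantics $\mathscr A\models\exists^{\log^k}X\phi$ iff there is $S\subseteq A^{\mathrm{arity}(X)}$ with $|S|\le\log^k(|A|)$ such that $\mathscr A\models\phi[X/S]$. Formulas of $\exists^{\log^\omega}\mathrm{IFP}$ have the form $\exists^{\log^{k_1}}X_1\cdots\exists^{\log^{k_m}}X_m\psi$ with $m\ge0$, $k_i>0$ and $\psi$ an IFP-formula. *)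

theory Defs
  imports Complex_Main
begin

section \<open>Syntax of IFP over the signature of graphs\<close>

text \<open>
  First-order variables are natural numbers.  The signature consists of one binary relation symbol
  and has no constants, so variables are the only terms.  Every relation variable carries its arity.
\<close>

type_synonym fovar = nat

datatype relvar = RV (rv_name: nat) (arity: nat)

text \<open>
  The remaining Boolean connectives and the universal quantifier are the usual abbreviations.
  \<open>Ifp X xs \<phi> ts\<close> is the formula \<open>[ifp X, xs. \<phi>](ts)\<close>.  The variable \<open>X\<close> may occur negatively
  in \<open>\<phi>\<close>, and \<open>\<phi>\<close> may have further free first-order and relation variables as parameters.
\<close>

datatype ifp_fm =
    Eq fovar fovar
  | Edge fovar fovar
  | Rel relvar "fovar list"
  | Neg ifp_fm
  | Conj ifp_fm ifp_fm
  | Ex fovar ifp_fm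
  | Ifp relvar "fovar list" ifp_fm "fovar list"

primrec wf_ifp :: "ifp_fm \<Rightarrow> bool" where
  "wf_ifp (Eq x y) \<longleftrightarrow> True"
| "wf_ifp (Edge x y) \<longleftrightarrow> True"
| "wf_ifp (Rel X xs) \<longleftrightarrow> length xs = arity X"
| "wf_ifp (Neg \<phi>) \<longleftrightarrow> wf_ifp \<phi>"
| "wf_ifp (Conj \<phi> \<psi>) \<longleftrightarrow> wf_ifp \<phi> \<and> wf_ifp \<psi>"
| "wf_ifp (Ex x \<phi>) \<longleftrightarrow> wf_ifp \<phi>"
| "wf_ifp (Ifp X xs \<phi> ts) \<longleftrightarrow>
     distinct xs \<and> length xs = arity X \<and> length ts = arity X \<and> wf_ifp \<phi>"

primrec free_fo :: "ifp_fm \<Rightarrow> fovar set" where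
  "free_fo (Eq x y) = {x, y}"
| "free_fo (Edge x y) = {x, y}"
| "free_fo (Rel X xs) = set xs"
| "free_fo (Neg \<phi>) = free_fo \<phi>"
| "free_fo (Conj \<phi> \<psi>) = free_fo \<phi> \<union> free_fo \<psi>"
| "free_fo (Ex x \<phi>) = free_fo \<phi> - {x}"
| "free_fo (Ifp X xs \<phi> ts) = (free_fo \<phi> - set xs) \<union> set ts"

primrec free_rel :: "ifp_fm \<Rightarrow> relvar set" where
  "free_rel (Eq x y) = {}"
| "free_rel (Edge x y) = {}"
| "free_rel (Rel X xs) = {X}"
| "free_rel (Neg \<phi>) = free_rel \<phi>"
| "free_rel (Conj \<phi> \<psi>) = free_rel \<phi> \<union> free_rel \<psi>"
| "free_rel (Ex x \<phi>) = free_rel \<phi>"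
| "free_rel (Ifp X xs \<phi> ts) = free_rel \<phi> - {X}"


section \<open>Semantics of IFP\<close>

definition tuples :: "'a set \<Rightarrow> nat \<Rightarrow> 'a list set" where
  "tuples V k = {as. set as \<subseteq> V \<and> length as = k}"

definition assign_list :: "(fovar \<Rightarrow> 'a) \<Rightarrow> fovar list \<Rightarrow> 'a list \<Rightarrow> fovar \<Rightarrow> 'a" where
  "assign_list \<sigma> xs as = (\<lambda>y. case map_of (zip xs as) y of Some a \<Rightarrow> a | None \<Rightarrow> \<sigma> y)"

text \<open>
  The inflationary fixed point of an operator \<open>F\<close> on relations: the union of the stages
  \<open>R\<^sub>0 = \<emptyset>\<close> and \<open>R\<^sub>i\<^sub>+\<^sub>1 = R\<^sub>i \<union> F R\<^sub>i\<close>.  On a finite universe the stages become stationary after finitely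
  many steps, so no transfinite stages are needed.
\<close>

definition inflationary_fp :: "('b set \<Rightarrow> 'b set) \<Rightarrow> 'b set" where
  "inflationary_fp F = (\<Union>i. ((\<lambda>R. R \<union> F R) ^^ i) {})"

primrec sat_ifp ::
  "'a set \<Rightarrow> ('a \<times> 'a) set \<Rightarrow> (relvar \<Rightarrow> 'a list set) \<Rightarrow> (fovar \<Rightarrow> 'a) \<Rightarrow> ifp_fm \<Rightarrow> bool" where
  "sat_ifp V E \<rho> \<sigma> (Eq x y) \<longleftrightarrow> \<sigma> x = \<sigma> y"
| "sat_ifp V E \<rho> \<sigma> (Edge x y) \<longleftrightarrow> (\<sigma> x, \<sigma> y) \<in> E"
| "sat_ifp V E \<rho> \<sigma> (Rel X xs) \<longleftrightarrow> map \<sigma> xs \<in> \<rho> X"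
| "sat_ifp V E \<rho> \<sigma> (Neg \<phi>) \<longleftrightarrow> \<not> sat_ifp V E \<rho> \<sigma> \<phi>"
| "sat_ifp V E \<rho> \<sigma> (Conj \<phi> \<psi>) \<longleftrightarrow> sat_ifp V E \<rho> \<sigma> \<phi> \<and> sat_ifp V E \<rho> \<sigma> \<psi>"
| "sat_ifp V E \<rho> \<sigma> (Ex x \<phi>) \<longleftrightarrow> (\<exists>a\<in>V. sat_ifp V E \<rho> (\<sigma>(x := a)) \<phi>)"
| "sat_ifp V E \<rho> \<sigma> (Ifp X xs \<phi> ts) \<longleftrightarrow>
     map \<sigma> ts \<in> inflationary_fp
       (\<lambda>R. {as \<in> tuples V (arity X). sat_ifp V E (\<rho>(X := R)) (assign_list \<sigma> xs as) \<phi>})"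


section \<open>IFP with a prefix of polylogarithmically bounded second-order quantifiers\<close>

text \<open>
  \<open>ExLog k X \<phi>\<close> asserts the existence of a relation \<open>X\<close> with at most \<open>log\<^sup>k n\<close> tuples, where \<open>n\<close> is the
  size of the universe.  Such quantifiers occur only in front of an IFP formula.
\<close>

datatype log_fm = Ifp_Body ifp_fm | ExLog nat relvar log_fm

definition ceil_log :: "nat \<Rightarrow> nat" where
  "ceil_log n = nat \<lceil>log 2 (real n)\<rceil>"

primrec wf_log :: "log_fm \<Rightarrow> bool" where
  "wf_log (Ifp_Body \<psi>) \<longleftrightarrow> wf_ifp \<psi>"
| "wf_log (ExLog k X \<phi>) \<longleftrightarrow> k > 0 \<and> wf_log \<phi>"

primrec log_free_fo :: "log_fm \<Rightarrow> fovar set" where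
  "log_free_fo (Ifp_Body \<psi>) = free_fo \<psi>"
| "log_free_fo (ExLog k X \<phi>) = log_free_fo \<phi>"

primrec log_free_rel :: "log_fm \<Rightarrow> relvar set" where
  "log_free_rel (Ifp_Body \<psi>) = free_rel \<psi>"
| "log_free_rel (ExLog k X \<phi>) = log_free_rel \<phi> - {X}"

primrec sat_log ::
  "'a set \<Rightarrow> ('a \<times> 'a) set \<Rightarrow> (relvar \<Rightarrow> 'a list set) \<Rightarrow> (fovar \<Rightarrow> 'a) \<Rightarrow> log_fm \<Rightarrow> bool" where
  "sat_log V E \<rho> \<sigma> (Ifp_Body \<psi>) \<longleftrightarrow> sat_ifp V E \<rho> \<sigma> \<psi>"
| "sat_log V E \<rho> \<sigma> (ExLog k X \<phi>) \<longleftrightarrow>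
     (\<exists>S. S \<subseteq> tuples V (arity X) \<and> card S \<le> ceil_log (card V) ^ k \<and>
          sat_log V E (\<rho>(X := S)) \<sigma> \<phi>)"

definition log_sentence :: "log_fm \<Rightarrow> bool" where
  "log_sentence \<phi> \<longleftrightarrow> wf_log \<phi> \<and> log_free_fo \<phi> = {} \<and> log_free_rel \<phi> = {}"

text \<open>The choice of assignments is immaterial for sentences.\<close>

definition models :: "'a set \<Rightarrow> ('a \<times> 'a) set \<Rightarrow> log_fm \<Rightarrow> bool" where
  "models V E \<phi> \<longleftrightarrow>
     (\<forall>\<rho> \<sigma>. (\<forall>X. \<rho> X \<subseteq> tuples V (arity X)) \<longrightarrow> (\<forall>x. \<sigma> x \<in> V) \<longrightarrow> sat_log V E \<rho> \<sigma> \<phi>)"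

text \<open>
  Graphs are arbitrary finite structures with one binary relation (so they may be directed and have
  loops), with a nonempty universe as usual in finite model theory.  Up to isomorphism all of them occur
  with \<open>'a = nat\<close>.
\<close>

definition fin_graph :: "'a set \<Rightarrow> ('a \<times> 'a) set \<Rightarrow> bool" where
  "fin_graph V E \<longleftrightarrow> finite V \<and> V \<noteq> {} \<and> E \<subseteq> V \<times> V"

end

theory Submission
  imports Defs "HOL-Real_Asymp.Real_Asymp"
begin

text \<open>
  On edgeless graphs, witnesses for the second-order prefix touch only polylogarithmically many
  vertices, and IFP cannot count the untouched ones: a formula has the same truth value in two
  edgeless graphs whenever both have enough vertices outside the given partial isomorphism. So a
  sentence that holds in a large edgeless graph with an even number of vertices still holds, with the
  same witnesses, after one isolated vertex has been added.
\<close>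

section \<open>Partial injections and relations that correspond along them\<close>

text \<open>With no edges to preserve, these are exactly the partial isomorphisms. As sets of pairs
  they can be joined with the position-wise pairs of two tuples and inverted by
  \<open>converse\<close>.\<close>

definition partial_inj :: "('a \<times> 'b) set \<Rightarrow> bool" where
  "partial_inj P \<longleftrightarrow> (\<forall>a b c d. (a, b) \<in> P \<longrightarrow> (c, d) \<in> P \<longrightarrow> (a = c \<longleftrightarrow> b = d))"

lemma partial_injD: "partial_inj P \<Longrightarrow> (a, b) \<in> P \<Longrightarrow> (c, d) \<in> P \<Longrightarrow> a = c \<longleftrightarrow> b = d"
  unfolding partial_inj_def by blast

lemma partial_inj_subset: "partial_inj Q \<Longrightarrow> P \<subseteq> Q \<Longrightarrow> partial_inj P"
  unfolding partial_inj_def by blast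

lemma partial_inj_converse: "partial_inj (P\<inverse>) \<longleftrightarrow> partial_inj P"
  unfolding partial_inj_def by blast

text \<open>The move of the back-and-forth argument: a vertex that already has a partner keeps it,
  and otherwise the range of \<open>Q\<close> is too small to exhaust \<open>V'\<close>, which
  leaves a fresh partner.\<close>

lemma partial_inj_extend:
  assumes "partial_inj Q" "Q \<subseteq> V \<times> V'" "finite Q" "card Q < card V'"
  obtains b where "b \<in> V'" "partial_inj (insert (a, b) Q)"
proof (cases "a \<in> fst ` Q")
  case True
  then obtain b where "(a, b) \<in> Q" by force
  with assms that[of b] show ?thesis by (auto simp: insert_absorb)
next
  case False
  have "card (snd ` Q) < card V'"
    using card_image_le[OF assms(3), of snd] assms(4) by linarith
  then have "\<not> V' \<subseteq> snd ` Q"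
    using card_mono[of "snd ` Q" V'] assms(3) by auto
  then obtain b where "b \<in> V'" "b \<notin> snd ` Q" by blast
  with False assms(1) have "partial_inj (insert (a, b) Q)"
    unfolding partial_inj_def by (auto simp: image_iff)
  with \<open>b \<in> V'\<close> that show ?thesis by blast
qed

text \<open>
  Correspondence is relative to \<open>P\<close>, because the stages of a fixed point depend on the values of the
  free variables of its body.
\<close>

definition rel_corr :: "'a set \<Rightarrow> 'b set \<Rightarrow> ('a \<times> 'b) set \<Rightarrow> 'a list set \<Rightarrow> 'b list set \<Rightarrow> bool" where
  "rel_corr V V' P R R' \<longleftrightarrow>
     (\<forall>as bs. length as = length bs \<longrightarrow> set as \<subseteq> V \<longrightarrow> set bs \<subseteq> V' \<longrightarrow>
        partial_inj (P \<union> set (zip as bs)) \<longrightarrow> (as \<in> R \<longleftrightarrow> bs \<in> R'))"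

lemma rel_corrD:
  "\<lbrakk>rel_corr V V' P R R'; length as = length bs; set as \<subseteq> V; set bs \<subseteq> V';
    partial_inj (P \<union> set (zip as bs))\<rbrakk> \<Longrightarrow> as \<in> R \<longleftrightarrow> bs \<in> R'"
  unfolding rel_corr_def by blast

text \<open>A larger base is compatible with fewer pairs of tuples, so there is less to
  check.\<close>

lemma rel_corr_mono:
  assumes "rel_corr V V' P R R'" "P \<subseteq> Q"
  shows "rel_corr V V' Q R R'"
  unfolding rel_corr_def
proof (intro allI impI)
  fix as bs
  assume "length as = length bs" "set as \<subseteq> V" "set bs \<subseteq> V'"
    and "partial_inj (Q \<union> set (zip as bs))"
  moreover from this(4) have "partial_inj (P \<union> set (zip as bs))"
    by (rule partial_inj_subset) (use assms(2) in blast)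
  ultimately show "as \<in> R \<longleftrightarrow> bs \<in> R'"
    using assms(1) rel_corrD by blast
qed

text \<open>An injection that extends the identity on \<open>A\<close> can neither move an element
  of \<open>A\<close> nor send another element into \<open>A\<close>. A tuple over \<open>A\<close>
  is therefore matched only with itself. This is what allows a witness to be reused unchanged in a
  larger graph.\<close>

lemma rel_corr_Id_on:
  assumes "\<And>as. as \<in> R \<Longrightarrow> set as \<subseteq> A"
  shows "rel_corr V V' (Id_on A) R R"
  unfolding rel_corr_def
proof (intro allI impI)
  fix as bs
  assume len: "length as = length bs" and inj: "partial_inj (Id_on A \<union> set (zip as bs))"
  have nth: "as ! i = bs ! i" if "i < length as" "as ! i \<in> A \<or> bs ! i \<in> A" for i
  proof -
    have "(as ! i, bs ! i) \<in> set (zip as bs)"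
      using that len by (metis length_zip min.idem nth_mem nth_zip)
    moreover have "(as ! i, as ! i) \<in> Id_on A \<or> (bs ! i, bs ! i) \<in> Id_on A"
      using that by blast
    ultimately show ?thesis using partial_injD[OF inj] by blast
  qed
  have "as = bs" if "as \<in> R \<or> bs \<in> R"
  proof (rule nth_equalityI[OF len])
    fix i assume "i < length as"
    then show "as ! i = bs ! i"
      using that assms nth len by (metis nth_mem subsetD)
  qed
  then show "as \<in> R \<longleftrightarrow> bs \<in> R" by blast
qed

section \<open>Pairs of values under two assignments\<close>

text \<open>In terms of Ehrenfeucht-Fraisse games, these are the pairs of vertices carrying the
  pebbles named in \<open>X\<close>.\<close>

definition val_pairs :: "(fovar \<Rightarrow> 'a) \<Rightarrow> (fovar \<Rightarrow> 'b) \<Rightarrow> fovar set \<Rightarrow> ('a \<times> 'b) set" where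
  "val_pairs \<sigma> \<sigma>' X = (\<lambda>x. (\<sigma> x, \<sigma>' x)) ` X"

lemma val_pairs_Un: "val_pairs \<sigma> \<sigma>' (X \<union> Y) = val_pairs \<sigma> \<sigma>' X \<union> val_pairs \<sigma> \<sigma>' Y"
  unfolding val_pairs_def by blast

lemma val_pairs_set: "val_pairs \<sigma> \<sigma>' (set xs) = set (zip (map \<sigma> xs) (map \<sigma>' xs))"
  unfolding val_pairs_def by (induction xs) auto

lemma val_pairs_upd:
  "val_pairs (\<sigma>(x := a)) (\<sigma>'(x := b)) X \<subseteq> insert (a, b) (val_pairs \<sigma> \<sigma>' (X - {x}))"
  unfolding val_pairs_def by auto

lemma finite_val_pairs: "finite X \<Longrightarrow> finite (val_pairs \<sigma> \<sigma>' X)"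
  unfolding val_pairs_def by simp

lemma card_val_pairs: "finite X \<Longrightarrow> card (val_pairs \<sigma> \<sigma>' X) \<le> card X"
  unfolding val_pairs_def by (rule card_image_le)

lemma assign_list_notin: "y \<notin> set xs \<Longrightarrow> assign_list \<sigma> xs as y = \<sigma> y"
  unfolding assign_list_def
  by (auto split: option.splits dest!: map_of_SomeD set_zip_leftD)

lemma assign_list_nth:
  "distinct xs \<Longrightarrow> length as = length xs \<Longrightarrow> i < length xs \<Longrightarrow> assign_list \<sigma> xs as (xs ! i) = as ! i"
  unfolding assign_list_def by (simp add: map_of_zip_nth)

text \<open>A variable in \<open>xs\<close> contributes a pair of entries at the same position, any
  other variable its old pair. An inclusion suffices, since \<open>partial_inj\<close> passes to
  subsets.\<close>

lemma val_pairs_assign_list: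
  assumes "distinct xs" "length as = length xs" "length bs = length xs"
  shows "val_pairs (assign_list \<sigma> xs as) (assign_list \<sigma>' xs bs) X
    \<subseteq> val_pairs \<sigma> \<sigma>' (X - set xs) \<union> set (zip as bs)"
proof
  fix p assume "p \<in> val_pairs (assign_list \<sigma> xs as) (assign_list \<sigma>' xs bs) X"
  then obtain x where x: "x \<in> X" "p = (assign_list \<sigma> xs as x, assign_list \<sigma>' xs bs x)"
    unfolding val_pairs_def by blast
  show "p \<in> val_pairs \<sigma> \<sigma>' (X - set xs) \<union> set (zip as bs)"
  proof (cases "x \<in> set xs")
    case True
    then obtain i where "i < length xs" "x = xs ! i" by (metis in_set_conv_nth)
    then have "p = zip as bs ! i" "i < length (zip as bs)"
      using assms x by (auto simp: assign_list_nth)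
    then show ?thesis by (metis UnI2 nth_mem)
  next
    case False
    with x show ?thesis by (auto simp: val_pairs_def assign_list_notin)
  qed
qed

lemma finite_free_fo: "finite (free_fo \<phi>)"
  by (induction \<phi>) auto

section \<open>IFP cannot distinguish edgeless graphs with enough spare vertices\<close>

text \<open>\<open>N\<close> is the reserve of vertices demanded beyond \<open>P\<close>. The base
  \<open>P\<close>, over which the relations correspond, is kept apart from the values of the free
  variables: it may be large, whereas the reserve is to depend on the formula alone.\<close>

definition equi_sat :: "'a set \<Rightarrow> 'b set \<Rightarrow> nat \<Rightarrow> ifp_fm \<Rightarrow> bool" where
  "equi_sat V V' N \<phi> \<longleftrightarrow> (\<forall>P \<rho> \<rho>' \<sigma> \<sigma>'.
    finite P \<longrightarrow> card P + N \<le> card V \<longrightarrow> card P + N \<le> card V' \<longrightarrow>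
    P \<union> val_pairs \<sigma> \<sigma>' (free_fo \<phi>) \<subseteq> V \<times> V' \<longrightarrow>
    partial_inj (P \<union> val_pairs \<sigma> \<sigma>' (free_fo \<phi>)) \<longrightarrow>
    (\<forall>X\<in>free_rel \<phi>. rel_corr V V' P (\<rho> X) (\<rho>' X)) \<longrightarrow>
    (sat_ifp V {} \<rho> \<sigma> \<phi> \<longleftrightarrow> sat_ifp V' {} \<rho>' \<sigma>' \<phi>))"

lemma equi_satD:
  "\<lbrakk>equi_sat V V' N \<phi>; finite P; card P + N \<le> card V; card P + N \<le> card V';
    P \<union> val_pairs \<sigma> \<sigma>' (free_fo \<phi>) \<subseteq> V \<times> V';
    partial_inj (P \<union> val_pairs \<sigma> \<sigma>' (free_fo \<phi>));
    \<forall>X\<in>free_rel \<phi>. rel_corr V V' P (\<rho> X) (\<rho>' X)\<rbrakk>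
   \<Longrightarrow> sat_ifp V {} \<rho> \<sigma> \<phi> \<longleftrightarrow> sat_ifp V' {} \<rho>' \<sigma>' \<phi>"
  unfolding equi_sat_def by blast

text \<open>By induction on the formula. A quantifier is one back-and-forth move. For a fixed point,
  the stages correspond one by one, so neither their number nor the arity of \<open>X\<close> enters
  the reserve.\<close>

lemma ex_equi_sat:
  assumes "wf_ifp \<phi>"
  shows "\<exists>N. \<forall>(V :: 'a set) (V' :: 'b set). equi_sat V V' N \<phi>"
  using assms
proof (induction \<phi>)
  case (Eq x y)
  show ?case
    by (rule exI[of _ 0]) (auto simp: equi_sat_def val_pairs_def partial_inj_def)
next
  case (Edge x y)
  show ?case by (simp add: equi_sat_def)
next
  case (Rel X xs)
  have "sat_ifp V {} \<rho> \<sigma> (Rel X xs) \<longleftrightarrow> sat_ifp V' {} \<rho>' \<sigma>' (Rel X xs)"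
    if "P \<union> val_pairs \<sigma> \<sigma>' (set xs) \<subseteq> V \<times> V'" "partial_inj (P \<union> val_pairs \<sigma> \<sigma>' (set xs))"
      "rel_corr V V' P (\<rho> X) (\<rho>' X)"
    for V :: "'a set" and V' :: "'b set" and P \<rho> \<rho>' \<sigma> \<sigma>'
  proof -
    have "set (map \<sigma> xs) \<subseteq> V" "set (map \<sigma>' xs) \<subseteq> V'"
      using that(1) by (auto simp: val_pairs_def)
    with that(2,3) show ?thesis
      by (simp add: val_pairs_set rel_corrD)
  qed
  then show ?case by (auto simp: equi_sat_def)
next
  case (Neg \<phi>)
  then show ?case by (simp add: equi_sat_def)
next
  case (Conj \<phi> \<psi>)
  from Conj.IH(1) Conj.prems obtain N1 where N1: "equi_sat V V' N1 \<phi>" for V :: "'a set" and V' :: "'b set"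
    by (simp only: wf_ifp.simps) blast
  from Conj.IH(2) Conj.prems obtain N2 where N2: "equi_sat V V' N2 \<psi>" for V :: "'a set" and V' :: "'b set"
    by (simp only: wf_ifp.simps) blast
  show ?case
  \<comment> \<open>A larger reserve only strengthens the hypotheses, so any common upper bound of
    \<open>N1\<close> and \<open>N2\<close> would do.\<close>
  proof (intro exI[of _ "N1 + N2"] allI, unfold equi_sat_def, intro allI impI)
    fix V :: "'a set" and V' :: "'b set" and P \<rho> \<rho>' \<sigma> \<sigma>'
    assume hyps: "finite P" "card P + (N1 + N2) \<le> card V" "card P + (N1 + N2) \<le> card V'"
      "P \<union> val_pairs \<sigma> \<sigma>' (free_fo (Conj \<phi> \<psi>)) \<subseteq> V \<times> V'"
      "partial_inj (P \<union> val_pairs \<sigma> \<sigma>' (free_fo (Conj \<phi> \<psi>)))"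
      "\<forall>X\<in>free_rel (Conj \<phi> \<psi>). rel_corr V V' P (\<rho> X) (\<rho>' X)"
    have "sat_ifp V {} \<rho> \<sigma> \<phi> \<longleftrightarrow> sat_ifp V' {} \<rho>' \<sigma>' \<phi>"
      by (rule equi_satD[OF N1, of P]) (use hyps in \<open>auto simp: val_pairs_Un intro: partial_inj_subset\<close>)
    moreover have "sat_ifp V {} \<rho> \<sigma> \<psi> \<longleftrightarrow> sat_ifp V' {} \<rho>' \<sigma>' \<psi>"
      by (rule equi_satD[OF N2, of P]) (use hyps in \<open>auto simp: val_pairs_Un intro: partial_inj_subset\<close>)
    ultimately show "sat_ifp V {} \<rho> \<sigma> (Conj \<phi> \<psi>) \<longleftrightarrow> sat_ifp V' {} \<rho>' \<sigma>' (Conj \<phi> \<psi>)" by simp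
  qed
next
  case (Ex x \<phi>)
  from Ex.IH Ex.prems obtain N where N: "equi_sat V V' N \<phi>" for V :: "'a set" and V' :: "'b set"
    by (simp only: wf_ifp.simps) blast
  show ?case
  \<comment> \<open>The partner of the quantified vertex must respect \<open>P\<close> and the
    values of at most \<open>card (free_fo \<phi>)\<close> variables; the final 1 makes
    \<open>card Q\<close> strictly smaller than both universes.\<close>
  proof (intro exI[of _ "N + card (free_fo \<phi>) + 1"] allI, unfold equi_sat_def, intro allI impI)
    fix V :: "'a set" and V' :: "'b set" and P \<rho> \<rho>' \<sigma> \<sigma>'
    assume hyps: "finite P" "card P + (N + card (free_fo \<phi>) + 1) \<le> card V"
      "card P + (N + card (free_fo \<phi>) + 1) \<le> card V'"
      "P \<union> val_pairs \<sigma> \<sigma>' (free_fo (Ex x \<phi>)) \<subseteq> V \<times> V'"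
      "partial_inj (P \<union> val_pairs \<sigma> \<sigma>' (free_fo (Ex x \<phi>)))"
      "\<forall>X\<in>free_rel (Ex x \<phi>). rel_corr V V' P (\<rho> X) (\<rho>' X)"
    define Q where "Q = P \<union> val_pairs \<sigma> \<sigma>' (free_fo \<phi> - {x})"
    have Q: "finite Q" "partial_inj Q" "Q \<subseteq> V \<times> V'"
      using hyps finite_val_pairs[of "free_fo \<phi> - {x}" \<sigma> \<sigma>'] finite_free_fo[of \<phi>]
      unfolding Q_def by auto
    have "card Q \<le> card P + card (val_pairs \<sigma> \<sigma>' (free_fo \<phi> - {x}))"
      unfolding Q_def by (rule card_Un_le)
    also have "\<dots> \<le> card P + card (free_fo \<phi>)"
      using card_val_pairs[of "free_fo \<phi> - {x}" \<sigma> \<sigma>'] card_mono[of "free_fo \<phi>" "free_fo \<phi> - {x}"]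
        finite_free_fo[of \<phi>] by fastforce
    finally have cardQ: "card Q < card V" "card Q < card V'"
      using hyps(2,3) by linarith+
    \<comment> \<open>The induction hypothesis is used over \<open>P\<close>, not \<open>Q\<close>:
      the new pair enters through the assignments, so the correspondence of the relations is
      untouched.\<close>
    have step: "sat_ifp V {} \<rho> (\<sigma>(x := a)) \<phi> \<longleftrightarrow> sat_ifp V' {} \<rho>' (\<sigma>'(x := b)) \<phi>"
      if "a \<in> V" "b \<in> V'" "partial_inj (insert (a, b) Q)" for a b
    proof (rule equi_satD[OF N])
      have sub: "P \<union> val_pairs (\<sigma>(x := a)) (\<sigma>'(x := b)) (free_fo \<phi>) \<subseteq> insert (a, b) Q"
        using val_pairs_upd[of \<sigma> x a \<sigma>' b "free_fo \<phi>"] unfolding Q_def by blast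
      show "P \<union> val_pairs (\<sigma>(x := a)) (\<sigma>'(x := b)) (free_fo \<phi>) \<subseteq> V \<times> V'"
        using sub Q(3) that(1,2) by blast
      show "partial_inj (P \<union> val_pairs (\<sigma>(x := a)) (\<sigma>'(x := b)) (free_fo \<phi>))"
        using partial_inj_subset[OF that(3) sub] .
    qed (use hyps in simp_all)
    show "sat_ifp V {} \<rho> \<sigma> (Ex x \<phi>) \<longleftrightarrow> sat_ifp V' {} \<rho>' \<sigma>' (Ex x \<phi>)"
    proof
      assume "sat_ifp V {} \<rho> \<sigma> (Ex x \<phi>)"
      then obtain a where a: "a \<in> V" "sat_ifp V {} \<rho> (\<sigma>(x := a)) \<phi>" by auto
      obtain b where "b \<in> V'" "partial_inj (insert (a, b) Q)"
        using partial_inj_extend[OF Q(2,3,1) cardQ(2)] .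
      with a step show "sat_ifp V' {} \<rho>' \<sigma>' (Ex x \<phi>)" by auto
    next
      assume "sat_ifp V' {} \<rho>' \<sigma>' (Ex x \<phi>)"
      then obtain b where b: "b \<in> V'" "sat_ifp V' {} \<rho>' (\<sigma>'(x := b)) \<phi>" by auto
      \<comment> \<open>The "back" direction is the "forth" direction for the converse.\<close>
      have "partial_inj (Q\<inverse>)" "Q\<inverse> \<subseteq> V' \<times> V" "finite (Q\<inverse>)" "card (Q\<inverse>) < card V"
        using Q cardQ(1) by (auto simp: partial_inj_converse card_inverse)
      then obtain a where "a \<in> V" "partial_inj (insert (b, a) (Q\<inverse>))"
        by (rule partial_inj_extend)
      moreover have "insert (b, a) (Q\<inverse>) = (insert (a, b) Q)\<inverse>" by blast
      ultimately have "a \<in> V" "partial_inj (insert (a, b) Q)"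
        by (simp_all only: partial_inj_converse)
      with b step show "sat_ifp V {} \<rho> \<sigma> (Ex x \<phi>)" by auto
    qed
  qed
next
  case (Ifp X xs \<phi> ts)
  from Ifp.IH Ifp.prems obtain N where N: "equi_sat V V' N \<phi>" for V :: "'a set" and V' :: "'b set"
    by (simp only: wf_ifp.simps) blast
  from Ifp.prems have xs: "distinct xs" "length xs = arity X" "length ts = arity X" by simp_all
  show ?case
  \<comment> \<open>Here the induction hypothesis is used over \<open>Q\<close>, which has at most
    \<open>card (free_fo \<phi>)\<close> more pairs than \<open>P\<close>.\<close>
  proof (intro exI[of _ "N + card (free_fo \<phi>)"] allI, unfold equi_sat_def, intro allI impI)
    fix V :: "'a set" and V' :: "'b set" and P \<rho> \<rho>' \<sigma> \<sigma>'
    assume hyps: "finite P" "card P + (N + card (free_fo \<phi>)) \<le> card V"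
      "card P + (N + card (free_fo \<phi>)) \<le> card V'"
      "P \<union> val_pairs \<sigma> \<sigma>' (free_fo (Ifp X xs \<phi> ts)) \<subseteq> V \<times> V'"
      "partial_inj (P \<union> val_pairs \<sigma> \<sigma>' (free_fo (Ifp X xs \<phi> ts)))"
      "\<forall>Y\<in>free_rel (Ifp X xs \<phi> ts). rel_corr V V' P (\<rho> Y) (\<rho>' Y)"
    \<comment> \<open>The parameters of the body keep their values through all stages, while the
      entries for \<open>xs\<close> vary; hence only the parameters join the base.\<close>
    define Q where "Q = P \<union> val_pairs \<sigma> \<sigma>' (free_fo \<phi> - set xs)"
    define F where "F = (\<lambda>R. {as \<in> tuples V (arity X).
      sat_ifp V {} (\<rho>(X := R)) (assign_list \<sigma> xs as) \<phi>})"
    define F' where "F' = (\<lambda>R. {as \<in> tuples V' (arity X).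
      sat_ifp V' {} (\<rho>'(X := R)) (assign_list \<sigma>' xs as) \<phi>})"
    have finQ: "finite Q"
      using hyps(1) finite_val_pairs[of "free_fo \<phi> - set xs" \<sigma> \<sigma>'] finite_free_fo[of \<phi>]
      unfolding Q_def by auto
    \<comment> \<open>The hypotheses on the whole formula thus say that the two argument tuples are
      compatible with \<open>Q\<close>, which is what comparing them in each stage requires.\<close>
    have ts: "Q \<union> set (zip (map \<sigma> ts) (map \<sigma>' ts))
        = P \<union> val_pairs \<sigma> \<sigma>' (free_fo (Ifp X xs \<phi> ts))"
      unfolding Q_def val_pairs_set[symmetric] by (auto simp: val_pairs_Un)
    have QV: "Q \<subseteq> V \<times> V'"
      using hyps(4) ts by blast
    have tsV: "set (map \<sigma> ts) \<subseteq> V" "set (map \<sigma>' ts) \<subseteq> V'"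
      using hyps(4) by (auto simp: val_pairs_def)
    have "card Q \<le> card P + card (val_pairs \<sigma> \<sigma>' (free_fo \<phi> - set xs))"
      unfolding Q_def by (rule card_Un_le)
    also have "\<dots> \<le> card P + card (free_fo \<phi>)"
      using card_val_pairs[of "free_fo \<phi> - set xs" \<sigma> \<sigma>']
        card_mono[of "free_fo \<phi>" "free_fo \<phi> - set xs"] finite_free_fo[of \<phi>] by fastforce
    finally have cardQ: "card Q + N \<le> card V" "card Q + N \<le> card V'"
      using hyps(2,3) by linarith+
    have F_corr: "rel_corr V V' Q (F R) (F' R')" if RR: "rel_corr V V' Q R R'" for R R'
      unfolding rel_corr_def
    proof (intro allI impI)
      fix as bs
      assume len: "length as = length bs" and V: "set as \<subseteq> V" "set bs \<subseteq> V'"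
        and inj: "partial_inj (Q \<union> set (zip as bs))"
      have "sat_ifp V {} (\<rho>(X := R)) (assign_list \<sigma> xs as) \<phi> \<longleftrightarrow>
          sat_ifp V' {} (\<rho>'(X := R')) (assign_list \<sigma>' xs bs) \<phi>" if "length as = arity X"
      proof (rule equi_satD[OF N finQ cardQ])
        have sub: "Q \<union> val_pairs (assign_list \<sigma> xs as) (assign_list \<sigma>' xs bs) (free_fo \<phi>)
            \<subseteq> Q \<union> set (zip as bs)"
          using val_pairs_assign_list[of xs as bs \<sigma> \<sigma>' "free_fo \<phi>"] that len xs
          unfolding Q_def by auto
        have "set (zip as bs) \<subseteq> V \<times> V'"
          using V by (auto dest: set_zip_leftD set_zip_rightD)
        with sub QV show "Q \<union> val_pairs (assign_list \<sigma> xs as) (assign_list \<sigma>' xs bs) (free_fo \<phi>)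
            \<subseteq> V \<times> V'" by blast
        show "partial_inj (Q \<union> val_pairs (assign_list \<sigma> xs as) (assign_list \<sigma>' xs bs) (free_fo \<phi>))"
          using partial_inj_subset[OF inj sub] .
        have "P \<subseteq> Q" unfolding Q_def by blast
        with hyps(6) RR show "\<forall>Y\<in>free_rel \<phi>. rel_corr V V' Q ((\<rho>(X := R)) Y) ((\<rho>'(X := R')) Y)"
          by (auto intro: rel_corr_mono)
      qed
      then show "as \<in> F R \<longleftrightarrow> bs \<in> F' R'"
        unfolding F_def F'_def tuples_def using len V by auto
    qed
    \<comment> \<open>Stages with the same index are compared, so it does not matter when the two
      iterations become stationary.\<close>
    have stage: "rel_corr V V' Q (((\<lambda>R. R \<union> F R) ^^ i) {}) (((\<lambda>R. R \<union> F' R) ^^ i) {})" for i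
    proof (induction i)
      case 0
      show ?case by (simp add: rel_corr_def)
    next
      case (Suc i)
      from Suc F_corr[OF Suc] show ?case by (auto simp: rel_corr_def)
    qed
    have "map \<sigma> ts \<in> ((\<lambda>R. R \<union> F R) ^^ i) {} \<longleftrightarrow> map \<sigma>' ts \<in> ((\<lambda>R. R \<union> F' R) ^^ i) {}" for i
      by (rule rel_corrD[OF stage _ tsV]) (simp_all add: ts hyps(5) del: free_fo.simps)
    then show "sat_ifp V {} \<rho> \<sigma> (Ifp X xs \<phi> ts) \<longleftrightarrow> sat_ifp V' {} \<rho>' \<sigma>' (Ifp X xs \<phi> ts)"
      unfolding sat_ifp.simps F_def[symmetric] F'_def[symmetric] inflationary_fp_def by blast
  qed
qed

section \<open>Growth of the logarithmic bounds\<close>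

lemma ceil_log_mono: "0 < m \<Longrightarrow> m \<le> n \<Longrightarrow> ceil_log m \<le> ceil_log n"
  unfolding ceil_log_def by (intro nat_mono ceiling_mono) simp

text \<open>Rounding up adds at most 1 to the logarithm, and powers of a logarithm are o(n). With an
  arity for \<open>c\<close>, the numerator bounds the number of vertices that one witness
  touches.\<close>

lemma ceil_log_power_sublinear: "(\<lambda>n. real (c * ceil_log n ^ k) / real n) \<longlonglongrightarrow> 0"
proof (rule tendsto_sandwich[of "\<lambda>_. 0" _ _
      "\<lambda>n. real c * ((log 2 (real n) + 1) ^ k / real n)"])
  show "(\<lambda>n. real c * ((log 2 (real n) + 1) ^ k / real n)) \<longlonglongrightarrow> 0"
  proof (rule tendsto_mult_right_zero)
    show "(\<lambda>n. (log 2 (real n) + 1) ^ k / real n) \<longlonglongrightarrow> 0"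
      by real_asymp
  qed
  show "\<forall>\<^sub>F n in sequentially.
      real (c * ceil_log n ^ k) / real n \<le> real c * ((log 2 (real n) + 1) ^ k / real n)"
  proof (rule eventually_sequentiallyI)
    fix n :: nat assume "1 \<le> n"
    then have "0 \<le> log 2 (real n)" by simp
    then have "real (ceil_log n) \<le> log 2 (real n) + 1"
      unfolding ceil_log_def by linarith
    then have "real (ceil_log n) ^ k \<le> (log 2 (real n) + 1) ^ k"
      by (rule power_mono) simp
    then show "real (c * ceil_log n ^ k) / real n \<le> real c * ((log 2 (real n) + 1) ^ k / real n)"
      by (simp add: divide_right_mono mult_left_mono)
  qed
qed simp_all

section \<open>Transfer of the second-order prefix to a larger edgeless graph\<close>

text \<open>\<open>A\<close> collects the vertices touched by the relations chosen so far, and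
  \<open>f\<close> is the reserve that the rest of the formula still needs. Truth is transferred
  upwards only, since a witness in \<open>V'\<close> may use vertices outside \<open>V\<close> or
  exceed the bound for \<open>V\<close>. Sublinearity is all that is recorded of \<open>f\<close>,
  as it survives adding the cost of another quantifier.\<close>

lemma sat_log_extend:
  assumes "wf_log \<phi>" "log_free_fo \<phi> = {}"
  shows "\<exists>f. (\<lambda>n. real (f n) / real n) \<longlonglongrightarrow> 0 \<and>
    (\<forall>(V :: 'a set) V' A \<rho> \<rho>' \<sigma> \<sigma>'.
      finite V' \<longrightarrow> V \<noteq> {} \<longrightarrow> V \<subseteq> V' \<longrightarrow> A \<subseteq> V \<longrightarrow> card A + f (card V) \<le> card V \<longrightarrow>
      (\<forall>X\<in>log_free_rel \<phi>. \<rho> X = \<rho>' X \<and> (\<forall>as\<in>\<rho> X. set as \<subseteq> A)) \<longrightarrow>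
      sat_log V {} \<rho> \<sigma> \<phi> \<longrightarrow> sat_log V' {} \<rho>' \<sigma>' \<phi>)"
  using assms
proof (induction \<phi>)
  case (Ifp_Body \<psi>)
  then have "wf_ifp \<psi>" and closed: "val_pairs \<sigma> \<sigma>' (free_fo \<psi>) = {}" for \<sigma> \<sigma>' :: "fovar \<Rightarrow> 'a"
    by (simp_all add: val_pairs_def)
  then obtain N where N: "equi_sat V V' N \<psi>" for V V' :: "'a set"
    using ex_equi_sat by blast
  have "(\<lambda>n. real N / real n) \<longlonglongrightarrow> 0" by real_asymp
  moreover have "sat_ifp V' {} \<rho>' \<sigma>' \<psi>"
    if "finite V'" "V \<subseteq> V'" "A \<subseteq> V" "card A + N \<le> card V"
      "\<forall>X\<in>free_rel \<psi>. \<rho> X = \<rho>' X \<and> (\<forall>as\<in>\<rho> X. set as \<subseteq> A)" "sat_ifp V {} \<rho> \<sigma> \<psi>"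
    for V V' A :: "'a set" and \<rho> \<rho>' \<sigma> \<sigma>'
  proof -
    have fin: "finite A" using that(1-3) by (meson finite_subset)
    have Id: "Id_on A = (\<lambda>a. (a, a)) ` A" by (auto simp: Id_on_def)
    have "card (Id_on A) = card A"
      unfolding Id by (rule card_image) (simp add: inj_on_def)
    moreover have "card V \<le> card V'" using that(1,2) by (rule card_mono)
    moreover have "partial_inj (Id_on A)" unfolding partial_inj_def by auto
    \<comment> \<open>The relations are the same on both sides and live on \<open>A\<close>, so the
      identity on \<open>A\<close> serves as the base.\<close>
    moreover have "\<forall>X\<in>free_rel \<psi>. rel_corr V V' (Id_on A) (\<rho> X) (\<rho>' X)"
    proof
      fix X assume "X \<in> free_rel \<psi>"
      with that(5) have "\<rho>' X = \<rho> X" "\<And>as. as \<in> \<rho> X \<Longrightarrow> set as \<subseteq> A" by auto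
      then show "rel_corr V V' (Id_on A) (\<rho> X) (\<rho>' X)" by (simp add: rel_corr_Id_on)
    qed
    ultimately have "sat_ifp V {} \<rho> \<sigma> \<psi> \<longleftrightarrow> sat_ifp V' {} \<rho>' \<sigma>' \<psi>"
      by (intro equi_satD[OF N, of "Id_on A"]) (use that(2-4) fin Id closed in auto)
    with that(6) show ?thesis by blast
  qed
  ultimately show ?case
    unfolding sat_log.simps log_free_rel.simps by (intro exI[of _ "\<lambda>_. N"]) blast
next
  case (ExLog k X \<phi>)
  then obtain f where f: "(\<lambda>n. real (f n) / real n) \<longlonglongrightarrow> 0" and IH:
    "\<And>(V :: 'a set) V' A \<rho> \<rho>' \<sigma> \<sigma>'.
      \<lbrakk>finite V'; V \<noteq> {}; V \<subseteq> V'; A \<subseteq> V; card A + f (card V) \<le> card V;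
       \<forall>X\<in>log_free_rel \<phi>. \<rho> X = \<rho>' X \<and> (\<forall>as\<in>\<rho> X. set as \<subseteq> A);
       sat_log V {} \<rho> \<sigma> \<phi>\<rbrakk> \<Longrightarrow> sat_log V' {} \<rho>' \<sigma>' \<phi>"
    by (simp only: wf_log.simps log_free_fo.simps) blast
  \<comment> \<open>A witness has at most \<open>ceil_log n ^ k\<close> tuples with at most
    \<open>arity X\<close> distinct entries each. Those entries are moved into \<open>A\<close>, and
    \<open>f n\<close> is left for the remaining formula.\<close>
  define g where "g n = arity X * ceil_log n ^ k + f n" for n
  have "(\<lambda>n. real (g n) / real n) \<longlonglongrightarrow> 0"
    using tendsto_add[OF ceil_log_power_sublinear[of "arity X" k] f]
    by (simp add: g_def add_divide_distrib)
  moreover have "sat_log V' {} \<rho>' \<sigma>' (ExLog k X \<phi>)"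
    if V: "finite V'" "V \<noteq> {}" "V \<subseteq> V'" "A \<subseteq> V" "card A + g (card V) \<le> card V"
      and \<rho>: "\<forall>Y\<in>log_free_rel (ExLog k X \<phi>). \<rho> Y = \<rho>' Y \<and> (\<forall>as\<in>\<rho> Y. set as \<subseteq> A)"
      and sat: "sat_log V {} \<rho> \<sigma> (ExLog k X \<phi>)"
    for V V' A :: "'a set" and \<rho> \<rho>' \<sigma> \<sigma>'
  proof -
    from sat obtain S where S: "S \<subseteq> tuples V (arity X)" "card S \<le> ceil_log (card V) ^ k"
      "sat_log V {} (\<rho>(X := S)) \<sigma> \<phi>" by auto
    have finV: "finite V" using V(1,3) by (rule finite_subset[rotated])
    then have "finite (tuples V (arity X))"
      unfolding tuples_def by (rule finite_lists_length_eq)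
    with S(1) have "finite S" by (rule finite_subset)
    then have "card (\<Union>as\<in>S. set as) \<le> (\<Sum>as\<in>S. card (set as))"
      by (rule card_UN_le)
    also have "\<dots> \<le> (\<Sum>as\<in>S. arity X)"
    proof (rule sum_mono)
      fix as assume "as \<in> S"
      with S(1) have "length as = arity X" by (auto simp: tuples_def)
      with card_length[of as] show "card (set as) \<le> arity X" by simp
    qed
    also have "\<dots> \<le> arity X * ceil_log (card V) ^ k"
      using S(2) by simp
    finally have cardA: "card (A \<union> (\<Union>as\<in>S. set as)) + f (card V) \<le> card V"
      using card_Un_le[of A "\<Union>as\<in>S. set as"] V(5) unfolding g_def by linarith
    have subA: "A \<union> (\<Union>as\<in>S. set as) \<subseteq> V"
      using V(4) S(1) by (auto simp: tuples_def)
    have "\<forall>Y\<in>log_free_rel \<phi>. (\<rho>(X := S)) Y = (\<rho>'(X := S)) Y \<and>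
        (\<forall>as\<in>(\<rho>(X := S)) Y. set as \<subseteq> A \<union> (\<Union>as\<in>S. set as))"
      using \<rho> by auto
    then have "sat_log V' {} (\<rho>'(X := S)) \<sigma>' \<phi>"
      using S(3) by (rule IH[OF V(1-3) subA cardA])
    moreover have "S \<subseteq> tuples V' (arity X)"
      using S(1) V(3) by (auto simp: tuples_def)
    \<comment> \<open>The size bound does not shrink as the universe grows, so the same
      \<open>S\<close> is admissible in \<open>V'\<close>.\<close>
    moreover have "ceil_log (card V) ^ k \<le> ceil_log (card V') ^ k"
      using V(1-3) finV by (intro power_mono ceil_log_mono card_mono) (auto simp: card_gt_0_iff)
    ultimately show ?thesis using S(2) by auto
  qed
  ultimately show ?case by (intro exI[of _ g] conjI allI impI) assumption+
qed

section \<open>Adding one isolated vertex changes the parity\<close>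

theorem theorem4p1:
  shows "\<not> (\<exists>\<phi>. log_sentence \<phi> \<and>
           (\<forall>(V :: nat set) E. fin_graph V E \<longrightarrow> (models V E \<phi> \<longleftrightarrow> even (card V))))"
proof
  assume "\<exists>\<phi>. log_sentence \<phi> \<and>
    (\<forall>(V :: nat set) E. fin_graph V E \<longrightarrow> (models V E \<phi> \<longleftrightarrow> even (card V)))"
  then obtain \<phi> where \<phi>: "wf_log \<phi>" "log_free_fo \<phi> = {}" "log_free_rel \<phi> = {}"
    and even: "\<And>(V :: nat set) E. fin_graph V E \<Longrightarrow> models V E \<phi> \<longleftrightarrow> even (card V)"
    unfolding log_sentence_def by blast
  from sat_log_extend[OF \<phi>(1,2), where 'a = nat] obtain f
    where f: "(\<lambda>n. real (f n) / real n) \<longlonglongrightarrow> 0"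
      and ext: "\<forall>(V :: nat set) V' A \<rho> \<rho>' \<sigma> \<sigma>'.
        finite V' \<longrightarrow> V \<noteq> {} \<longrightarrow> V \<subseteq> V' \<longrightarrow> A \<subseteq> V \<longrightarrow> card A + f (card V) \<le> card V \<longrightarrow>
        (\<forall>X\<in>log_free_rel \<phi>. \<rho> X = \<rho>' X \<and> (\<forall>as\<in>\<rho> X. set as \<subseteq> A)) \<longrightarrow>
        sat_log V {} \<rho> \<sigma> \<phi> \<longrightarrow> sat_log V' {} \<rho>' \<sigma>' \<phi>"
    by (elim exE conjE)
  from f have "\<forall>\<^sub>F n in sequentially. real (f n) / real n < 1"
    by (rule order_tendstoD) simp
  then obtain M where M: "\<And>n. n \<ge> M \<Longrightarrow> real (f n) / real n < 1"
    by (auto simp: eventually_sequentially)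
  \<comment> \<open>The factor 2 makes \<open>n\<close> even, and the summand 1 makes it positive,
    so that the quotient below 1 does yield \<open>f n \<le> n\<close>.\<close>
  define n where "n = 2 * (M + 1)"
  have "n > 0" "real (f n) / real n < 1"
    using M[of n] by (simp_all add: n_def)
  then have fn: "f n \<le> n" by (simp add: field_simps)
  let ?V = "{..<n}" and ?V' = "{..<Suc n}"
  have "fin_graph ?V {}" "fin_graph ?V' {}"
    using \<open>n > 0\<close> by (auto simp: fin_graph_def)
  with even have models: "models ?V {} \<phi>" "\<not> models ?V' {} \<phi>"
    by (simp_all add: n_def)
  from models(1) \<open>n > 0\<close> have "sat_log ?V {} (\<lambda>_. {}) (\<lambda>_. 0) \<phi>"
    unfolding models_def by simp
  \<comment> \<open>A sentence has no free relation variables, so no vertex is touched at the start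
    and \<open>A\<close> is empty. As \<rho>' and \<sigma>' are arbitrary, one satisfying pair on
    the smaller graph gives \<open>models\<close> on the larger one.\<close>
  then have "sat_log ?V' {} \<rho>' \<sigma>' \<phi>" for \<rho>' \<sigma>'
    by (rule ext[rule_format, of ?V' ?V "{}", rotated -1])
      (use \<open>n > 0\<close> fn \<phi>(3) in \<open>auto simp: lessThan_empty_iff\<close>)
  with models(2) show False unfolding models_def by blast
qed

end
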